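(* Let $(h_{ji})$, $1\le j\le s$, $1\le i\le p$, be an arbitrary row stochastic matrix. Assume that the positive numbers $\alpha_1,\dots,\alpha_p$, $\beta_1,\dots,\beta_s$, $A_1,\dots,A_p$, $B_1,\dots,B_s$ and the nonnegative numbers $a_1,\dots,a_p$, $b_1,\dots,b_s$ satisfy $$\alpha_iA_i\ge\sum_{j=1}^s\beta_jB_jh_{ji}\quad\text{for } i=1,\dots,p,\qquad b_j\ge B_j\sum_{i=1}^p\frac{a_i}{A_i}h_{ji}+1\quad\text{for } j=1,\dots,s.$$ Then $$Q(u):=\sum_{i=1}^p\frac{\alpha_ie^{-a_iu/A_i}}{1-e^{-u/A_i}}-\sum_{j=1}^s\frac{\beta_je^{-b_ju/B_j}}{1-e^{-u/B_j}}\ge0\quad\text{for all } u>0.$$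
   Context: A real $s\times p$ matrix $(h_{ji})$ is row stochastic if $h_{ji}\ge0$ for all $j,i$ and $\sum_{i=1}^ph_{ji}=1$ for each $j=1,\dots,s$. *)

theory Defs
  imports "HOL-Analysis.Analysis"
begin

text \<open>Rows are indexed by \<open>'s\<close> and columns by \<open>'p\<close>, so \<open>h $ j $ i\<close> is the entry in row \<open>j\<close>, column \<open>i\<close>.\<close>

definition row_stochastic :: "real ^ 'p ^ 's \<Rightarrow> bool" where
  "row_stochastic h \<longleftrightarrow>
     (\<forall>j i. h $ j $ i \<ge> 0) \<and> (\<forall>j. (\<Sum>i\<in>UNIV. h $ j $ i) = 1)"

end

theory Submission
  imports Defs
begin

text \<open>
  Both sums can be compared with sums of plain exponentials. For \<open>t > 0\<close> the inequality
  \<open>1 - exp (- t) \<le> t\<close> bounds every term \<open>\<alpha> i * exp (- x i) / (1 - exp (- u / A i))\<close>, where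
  \<open>x i = a i * u / A i\<close>, from below by \<open>\<alpha> i * A i * exp (- x i) / u\<close>
  (lemma \<open>exp_neg_div_ge\<close>). A term of the second sum is bounded from above by
  \<open>\<beta> j * B j * exp (- (b j - 1) * u / B j) / u\<close>, at the price of one unit of \<open>b j\<close>
  (lemma \<open>exp_neg_mult_div_le\<close>); the summand \<open>1\<close> in the hypothesis on \<open>b\<close> pays for this unit.

  After these reductions only weights and exponents are left. The hypothesis on \<open>\<alpha>\<close> says that the
  weight \<open>\<alpha> i * A i\<close> of column \<open>i\<close> covers what the rows demand of it, namely \<open>\<beta> j * B j * h j i\<close>
  for each row \<open>j\<close>. Within one row, the entries \<open>h j i\<close> are probability weights, and
  Jensen's inequality for \<open>exp\<close> (lemma \<open>exp_neg_weighted_mean_le\<close>) together with the hypothesis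
  on \<open>b\<close> gives
  \<open>exp (- (b j - 1) * u / B j) \<le> exp (- (\<Sum>i. h j i * x i)) \<le> (\<Sum>i. h j i * exp (- x i))\<close>.
  Summing over the rows and exchanging the order of summation finishes the argument.
\<close>

lemma exp_neg_div_ge:
  fixes t y :: real
  assumes "t > 0"
  shows "exp (- y) / t \<le> exp (- y) / (1 - exp (- t))"
proof -
  have "1 - exp (- t) \<le> t"
    using exp_ge_add_one_self[of "- t"] by simp
  moreover have "1 - exp (- t) > 0"
    using assms by simp
  ultimately show ?thesis
    by (intro divide_left_mono mult_pos_pos assms) simp_all
qed

text \<open>
  Multiplying numerator and denominator by \<open>exp t\<close> lowers the exponent from \<open>b\<close> to \<open>b - 1\<close> and
  replaces the denominator by \<open>exp t - 1\<close>, which lies above its tangent \<open>t\<close>.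
\<close>

lemma exp_neg_mult_div_le:
  fixes t b :: real
  assumes "t > 0"
  shows "exp (- (b * t)) / (1 - exp (- t)) \<le> exp (- ((b - 1) * t)) / t"
proof -
  have "exp (- (b * t)) / (1 - exp (- t)) = (exp t * exp (- (b * t))) / (exp t * (1 - exp (- t)))"
    by simp
  also have "exp t * exp (- (b * t)) = exp (- ((b - 1) * t))"
    by (simp add: exp_add [symmetric] algebra_simps)
  also have "exp t * (1 - exp (- t)) = exp t - 1"
    by (simp add: right_diff_distrib exp_add [symmetric])
  also have "exp (- ((b - 1) * t)) / (exp t - 1) \<le> exp (- ((b - 1) * t)) / t"
    using exp_ge_add_one_self[of t] assms
    by (intro divide_left_mono mult_pos_pos) (linarith | simp)+
  finally show ?thesis .
qed

lemma exp_neg_weighted_mean_le: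
  fixes w x :: "'i \<Rightarrow> real"
  assumes "finite I" and "\<And>i. i \<in> I \<Longrightarrow> w i \<ge> 0" and "(\<Sum>i\<in>I. w i) = 1"
  shows "exp (- (\<Sum>i\<in>I. w i * x i)) \<le> (\<Sum>i\<in>I. w i * exp (- x i))"
proof -
  have "I \<noteq> {}"
    using assms(3) by auto
  then have "exp (\<Sum>i\<in>I. w i *\<^sub>R - x i) \<le> (\<Sum>i\<in>I. w i * exp (- x i))"
    using assms by (intro convex_on_sum[OF _ _ exp_convex]) simp_all
  then show ?thesis
    by (simp add: sum_negf)
qed

theorem theorem3p7:
  fixes h :: "real ^ 'p ^ 's"
    and \<alpha> A a :: "real ^ 'p"
    and \<beta> B b :: "real ^ 's"
  assumes "row_stochastic h"
    and "\<And>i. \<alpha> $ i > 0" and "\<And>j. \<beta> $ j > 0"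
    and "\<And>i. A $ i > 0" and "\<And>j. B $ j > 0"
    and "\<And>i. a $ i \<ge> 0" and "\<And>j. b $ j \<ge> 0"
    and "\<And>i. \<alpha> $ i * A $ i \<ge> (\<Sum>j\<in>UNIV. \<beta> $ j * B $ j * h $ j $ i)"
    and "\<And>j. b $ j \<ge> B $ j * (\<Sum>i\<in>UNIV. a $ i / A $ i * h $ j $ i) + 1"
  shows "\<forall>u::real. u > 0 \<longrightarrow>
    (\<Sum>i\<in>UNIV. \<alpha> $ i * exp (- (a $ i * u / A $ i)) / (1 - exp (- (u / A $ i))))
    - (\<Sum>j\<in>UNIV. \<beta> $ j * exp (- (b $ j * u / B $ j)) / (1 - exp (- (u / B $ j)))) \<ge> 0"
proof (intro allI impI)
  fix u :: real
  assume u: "u > 0"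
  define x where "x i = a $ i * u / A $ i" for i
  have h_nonneg: "h $ j $ i \<ge> 0" and h_sum: "(\<Sum>i\<in>UNIV. h $ j $ i) = 1" for i j
    using assms(1) by (auto simp: row_stochastic_def)
  have row: "\<beta> $ j * exp (- (b $ j * u / B $ j)) / (1 - exp (- (u / B $ j)))
      \<le> (\<Sum>i\<in>UNIV. \<beta> $ j * B $ j * h $ j $ i * exp (- x i)) / u" for j
  proof -
    have "B $ j * (\<Sum>i\<in>UNIV. h $ j $ i * x i) = (B $ j * (\<Sum>i\<in>UNIV. a $ i / A $ i * h $ j $ i)) * u"
      by (simp add: x_def sum_distrib_left sum_distrib_right mult_ac)
    also have "\<dots> \<le> (b $ j - 1) * u"
      using assms(9)[of j] u by (intro mult_right_mono) simp_all
    finally have mean: "(\<Sum>i\<in>UNIV. h $ j $ i * x i) \<le> (b $ j - 1) * (u / B $ j)"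
      using assms(5)[of j] by (simp add: pos_le_divide_eq mult.commute)
    have "exp (- (b $ j * (u / B $ j))) / (1 - exp (- (u / B $ j)))
        \<le> exp (- ((b $ j - 1) * (u / B $ j))) / (u / B $ j)"
      using u assms(5)[of j] by (intro exp_neg_mult_div_le) simp
    also have "\<dots> \<le> exp (- (\<Sum>i\<in>UNIV. h $ j $ i * x i)) / (u / B $ j)"
      using u assms(5)[of j] mean by (intro divide_right_mono) simp_all
    also have "\<dots> \<le> (\<Sum>i\<in>UNIV. h $ j $ i * exp (- x i)) / (u / B $ j)"
      using u assms(5)[of j] h_nonneg h_sum
      by (intro divide_right_mono exp_neg_weighted_mean_le) (simp_all add: less_imp_le)
    finally have "\<beta> $ j * (exp (- (b $ j * (u / B $ j))) / (1 - exp (- (u / B $ j))))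
        \<le> \<beta> $ j * ((\<Sum>i\<in>UNIV. h $ j $ i * exp (- x i)) / (u / B $ j))"
      using assms(3)[of j] by (intro mult_left_mono) simp_all
    then show ?thesis
      by (simp add: sum_distrib_left mult_ac)
  qed
  have column: "(\<Sum>j\<in>UNIV. \<beta> $ j * B $ j * h $ j $ i * exp (- x i)) / u
      \<le> \<alpha> $ i * exp (- x i) / (1 - exp (- (u / A $ i)))" for i
  proof -
    have "(\<Sum>j\<in>UNIV. \<beta> $ j * B $ j * h $ j $ i * exp (- x i)) / u
        \<le> \<alpha> $ i * A $ i * exp (- x i) / u"
      unfolding sum_distrib_right [symmetric]
      using u assms(8)[of i] by (intro divide_right_mono mult_right_mono) simp_all
    also have "\<dots> = \<alpha> $ i * (exp (- x i) / (u / A $ i))"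
      by simp
    also have "\<dots> \<le> \<alpha> $ i * (exp (- x i) / (1 - exp (- (u / A $ i))))"
      using u assms(2,4)[of i] by (intro mult_left_mono exp_neg_div_ge) simp_all
    finally show ?thesis
      by simp
  qed
  have "(\<Sum>j\<in>UNIV. \<beta> $ j * exp (- (b $ j * u / B $ j)) / (1 - exp (- (u / B $ j))))
      \<le> (\<Sum>j\<in>UNIV. (\<Sum>i\<in>UNIV. \<beta> $ j * B $ j * h $ j $ i * exp (- x i)) / u)"
    by (intro sum_mono row)
  also have "\<dots> = (\<Sum>i\<in>UNIV. (\<Sum>j\<in>UNIV. \<beta> $ j * B $ j * h $ j $ i * exp (- x i)) / u)"
    unfolding sum_divide_distrib by (rule sum.swap)
  also have "\<dots> \<le> (\<Sum>i\<in>UNIV. \<alpha> $ i * exp (- x i) / (1 - exp (- (u / A $ i))))"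
    by (intro sum_mono column)
  finally show "(\<Sum>i\<in>UNIV. \<alpha> $ i * exp (- (a $ i * u / A $ i)) / (1 - exp (- (u / A $ i))))
    - (\<Sum>j\<in>UNIV. \<beta> $ j * exp (- (b $ j * u / B $ j)) / (1 - exp (- (u / B $ j)))) \<ge> 0"
    by (simp add: x_def)
qed

end
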